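(* For all integers $n\ge k\ge 1$, the varied Ward numbers of the second kind $S^*(n,k)$ satisfy $$S^*(n,k)=\frac{2nk(2n-1)}{n+k}\Big(S^*(n-1,k)+S^*(n-1,k-1)\Big),$$ with $S^*(0,0)=1$, $S^*(n,0)=0$ for $n\ge1$, $S^*(0,k)=0$ for $k\ge1$, and $S^*(n,k)=0$ for $k>n$.
   Context: Ward numbers of the second kind $S(n,k)$: defined for $n\ge k\ge 1$ by the recurrence $S(n,k)=k\,S(n-1,k)+(n+k-1)\,S(n-1,k-1)$, with $S(0,0)=1$, $S(n,0)=0$ for $n\ge 1$, $S(0,k)=0$ for $k\ge 1$, and $S(n,k)=0$ for $k>n$. Falling factorial: $x^{\underline{n}}=\prod_{i=0}^{n-1}(x-i)$, so $(n+k)^{\underline{n}}=\frac{(n+k)!}{k!}$. Varied Ward numbers of the second kind: for integers $n,k\ge 0$, $S^*(n,k)=\dfrac{(2n)!}{(n+k)^{\underline{n}}}\,S(n,k)$. *)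

theory Defs
  imports Complex_Main
begin

text \<open>Ward numbers of the second kind. In the last equation, with \<open>n + 1\<close> and \<open>k + 1\<close> as
  arguments, the factor \<open>(n + 1) + (k + 1) - 1\<close> does not truncate.\<close>

fun ward2 :: "nat \<Rightarrow> nat \<Rightarrow> nat" where
  "ward2 0 0 = 1"
| "ward2 (Suc n) 0 = 0"
| "ward2 0 (Suc k) = 0"
| "ward2 (Suc n) (Suc k) =
     (if Suc k > Suc n then 0
      else Suc k * ward2 n (Suc k) + (Suc n + Suc k - 1) * ward2 n k)"

definition falling_factorial :: "'a::comm_ring_1 \<Rightarrow> nat \<Rightarrow> 'a" where
  "falling_factorial x n = (\<Prod>i<n. x - of_nat i)"

text \<open>The varied Ward numbers are taken in the rationals, so that the division is exact.\<close>

definition varied_ward2 :: "nat \<Rightarrow> nat \<Rightarrow> rat" where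
  "varied_ward2 n k =
     fact (2 * n) / falling_factorial (of_nat (n + k)) n * of_nat (ward2 n k)"

end

theory Submission
  imports Defs
begin

text \<open>Splitting off the factor at \<open>i = 0\<close> lowers the base together with the
  length, so the induction on \<open>n\<close> at base \<open>n + k\<close> keeps \<open>k\<close>
  fixed.\<close>

lemma falling_factorial_Suc:
  "falling_factorial x (Suc n) = x * falling_factorial (x - 1) n"
  unfolding falling_factorial_def prod.lessThan_Suc_shift
  by (simp add: algebra_simps)

lemma falling_factorial_times_fact:
  "falling_factorial (of_nat (n + k)) n * fact k = (fact (n + k) :: rat)"
proof (induction n)
  case 0
  show ?case by (simp add: falling_factorial_def)
next
  case (Suc n)
  have shift: "(of_nat (Suc (n + k)) - 1 :: rat) = of_nat (n + k)" by simp
  show ?case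
    using Suc by (simp add: shift falling_factorial_Suc mult.assoc del: of_nat_Suc of_nat_add)
qed

lemma varied_ward2_altdef:
  "varied_ward2 n k = fact (2 * n) * fact k / fact (n + k) * of_nat (ward2 n k)"
  unfolding varied_ward2_def
  by (simp add: falling_factorial_times_fact[symmetric] del: of_nat_add)

lemma ward2_eq_0: "n < k \<Longrightarrow> ward2 n k = 0"
  by (induction n k rule: ward2.induct) auto

text \<open>Successor arguments avoid truncated subtraction and match the last equation of
  \<open>ward2\<close>.\<close>

lemma varied_ward2_Suc_Suc:
  assumes "j \<le> m"
  shows "varied_ward2 (Suc m) (Suc j) =
    (2 * of_nat (Suc m) * of_nat (Suc j) * (2 * of_nat (Suc m) - 1)) / of_nat (Suc m + Suc j)
      * (varied_ward2 m (Suc j) + varied_ward2 m j)"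
proof -
  \<comment> \<open>\<open>F\<close> is the smallest factorial of a sum that occurs; the other two
    are multiples of it.\<close>
  define F :: rat where "F = fact (m + j)"
  define a b :: rat where "a = of_nat (ward2 m (Suc j))" and "b = of_nat (ward2 m j)"
  have nz: "F \<noteq> 0" "(of_nat m + of_nat j + 1 :: rat) \<noteq> 0" "(of_nat m + of_nat j + 2 :: rat) \<noteq> 0"
    unfolding F_def by (simp, linarith+)
  \<comment> \<open>\<open>j \<le> m\<close> selects the nonzero branch of the
    \<open>if\<close>.\<close>
  have rec: "of_nat (ward2 (Suc m) (Suc j)) = (of_nat j + 1) * a + (of_nat m + of_nat j + 1) * b"
    using assms by (simp add: a_def b_def algebra_simps)
  have facts:
    "fact (2 * Suc m) = ((2 * of_nat m + 2) * (2 * of_nat m + 1) * fact (2 * m) :: rat)"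
    "fact (Suc j) = ((of_nat j + 1) * fact j :: rat)"
    "fact (m + Suc j) = (of_nat m + of_nat j + 1) * F"
    "fact (Suc m + Suc j) = (of_nat m + of_nat j + 2) * ((of_nat m + of_nat j + 1) * F)"
    by (simp_all add: F_def algebra_simps)
  have idx: "of_nat (Suc m + Suc j) = (of_nat m + of_nat j + 2 :: rat)"
    "of_nat (Suc m) = (of_nat m + 1 :: rat)" "of_nat (Suc j) = (of_nat j + 1 :: rat)"
    by simp_all
  \<comment> \<open>Once the denominators, nonzero by \<open>nz\<close>, are cleared, a polynomial
    identity remains, with \<open>fact (2 * m)\<close>, \<open>fact j\<close>, \<open>F\<close>,
    \<open>a\<close> and \<open>b\<close> as atoms.\<close>
  show ?thesis
    unfolding varied_ward2_altdef rec facts idx a_def[symmetric] b_def[symmetric] F_def[symmetric]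
    using nz by (simp add: divide_simps) algebra
qed

theorem theorem3p3:
  shows "(\<forall>n k :: nat. n \<ge> k \<and> k \<ge> 1 \<longrightarrow>
            varied_ward2 n k =
              (2 * of_nat n * of_nat k * (2 * of_nat n - 1)) / of_nat (n + k)
                * (varied_ward2 (n - 1) k + varied_ward2 (n - 1) (k - 1)))
       \<and> varied_ward2 0 0 = 1
       \<and> (\<forall>n :: nat. n \<ge> 1 \<longrightarrow> varied_ward2 n 0 = 0)
       \<and> (\<forall>k :: nat. k \<ge> 1 \<longrightarrow> varied_ward2 0 k = 0)
       \<and> (\<forall>n k :: nat. k > n \<longrightarrow> varied_ward2 n k = 0)"
proof (intro conjI allI impI)
  fix n k :: nat
  assume "n \<ge> k \<and> k \<ge> 1"
  then obtain m j where "n = Suc m" "k = Suc j" "j \<le> m"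
    by (cases n; cases k) auto
  then show "varied_ward2 n k =
      (2 * of_nat n * of_nat k * (2 * of_nat n - 1)) / of_nat (n + k)
        * (varied_ward2 (n - 1) k + varied_ward2 (n - 1) (k - 1))"
    using varied_ward2_Suc_Suc[of j m] by (simp only: diff_Suc_1)
next
  show "varied_ward2 0 0 = 1" by (simp add: varied_ward2_altdef)
next
  fix n :: nat
  assume "n \<ge> 1"
  then show "varied_ward2 n 0 = 0" by (cases n) (simp_all add: varied_ward2_def)
next
  fix k :: nat
  assume "k \<ge> 1"
  then show "varied_ward2 0 k = 0" by (simp add: varied_ward2_def ward2_eq_0)
next
  fix n k :: nat
  assume "k > n"
  then show "varied_ward2 n k = 0" by (simp add: varied_ward2_def ward2_eq_0)
qed

end
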